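(* Let $s\ge 1$ be an integer and let $0<x<1$ be real. Then the graded parafermionic partition function of order $s$, $$\Delta_s(x)=\prod_{k=1}^{\infty}\left(1-x^{k}+x^{2k}-\cdots+(-1)^{s-1}x^{(s-1)k}\right),$$ satisfies $$\Delta_s(x)=\prod_{k=1}^{\infty}\frac{1+(-1)^{s-1}x^{sk}}{1+x^{k}}.$$
   Context: The graded parafermionic partition function of order $s$ is defined as the infinite product $\Delta_s(x)=\prod_{k\ge1}\sum_{i=0}^{s-1}(-1)^i x^{ik}$, obtained from the parafermionic partition function $\prod_{k\ge1}\sum_{i=0}^{s-1}x^{ik}$ by replacing $x^k$ with $-x^k$ in each factor. In the physical setting $x=e^{-\beta\omega}$ with $\beta,\omega>0$. *)

theory Defs
  imports "HOL-Analysis.Analysis"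
begin

text \<open>The library's infinite products are indexed from \<open>0\<close>; the factor with index \<open>k \<ge> 1\<close> is
  therefore taken at \<open>Suc k\<close>.\<close>

definition graded_parafermionic_factor :: "nat \<Rightarrow> real \<Rightarrow> nat \<Rightarrow> real" where
  "graded_parafermionic_factor s x k = (\<Sum>i<s. (-1) ^ i * x ^ (i * k))"

definition graded_parafermionic :: "nat \<Rightarrow> real \<Rightarrow> real" where
  "graded_parafermionic s x = (\<Prod>k. graded_parafermionic_factor s x (Suc k))"

end

theory Submission
  imports Defs
begin

text \<open>Each factor is a finite geometric sum with ratio \<open>- (x ^ k)\<close>, so its closed
  form (\<open>graded_parafermionic_factor_eq\<close>) makes the two products agree factor by
  factor. What remains is convergence, without which \<open>prodinf\<close> need not be a limit:
  numerators and denominators both have the form \<open>1 + c * q ^ Suc k\<close> with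
  \<open>\<bar>q\<bar> < 1\<close> (\<open>convergent_prod_one_plus_geometric\<close>), and the
  quotient of the two products converges.\<close>

lemma graded_parafermionic_factor_eq:
  assumes "s \<ge> 1" and "0 < x"
  shows "graded_parafermionic_factor s x k = (1 + (-1) ^ (s - 1) * x ^ (s * k)) / (1 + x ^ k)"
proof -
  have pos: "0 < x ^ k" using assms by simp
  have "graded_parafermionic_factor s x k = (\<Sum>i<s. (- (x ^ k)) ^ i)"
    unfolding graded_parafermionic_factor_def
    by (intro sum.cong) (simp_all add: power_minus[of "x ^ k"] mult.commute flip: power_mult)
  \<comment> \<open>The ratio is negative, which rules out the case of ratio 1 in
    \<open>sum_gp_strict\<close>.\<close>
  also have "\<dots> = (1 - (- (x ^ k)) ^ s) / (1 + x ^ k)"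
    using pos by (subst sum_gp_strict) auto
  \<comment> \<open>The outer minus sign cancels one of the \<open>s\<close> signs; as
    \<open>s \<ge> 1\<close>, the subtraction \<open>s - 1\<close> does not truncate.\<close>
  also have "- ((- (x ^ k)) ^ s) = (-1) ^ (s - 1) * x ^ (s * k)"
    using assms(1) by (cases s) (simp_all add: power_minus[of "x ^ k"] power_add power_mult[symmetric] mult.commute)
  then have "1 - (- (x ^ k)) ^ s = 1 + (-1) ^ (s - 1) * x ^ (s * k)" by simp
  finally show ?thesis .
qed

text \<open>The deviations of the factors from 1 form an absolutely summable geometric series, so
  the product converges absolutely.\<close>

lemma convergent_prod_one_plus_geometric:
  fixes c q :: real
  assumes "\<bar>q\<bar> < 1"
  shows "convergent_prod (\<lambda>k. 1 + c * q ^ Suc k)"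
proof -
  have "summable (\<lambda>k. norm (c * q) * norm q ^ k)"
    using assms by (intro summable_mult summable_geometric) simp
  then have "summable (\<lambda>k. norm (1 + c * q ^ Suc k - 1))"
    by (simp add: abs_mult power_abs mult.assoc)
  then show ?thesis
    by (intro abs_convergent_prod_imp_convergent_prod) (simp add: abs_convergent_prod_conv_summable)
qed

theorem mainTheorem1:
  fixes s :: nat and x :: real
  assumes "s \<ge> 1" and "0 < x" and "x < 1"
  shows "convergent_prod (\<lambda>k. graded_parafermionic_factor s x (Suc k)) \<and>
         convergent_prod (\<lambda>k. (1 + (-1) ^ (s - 1) * x ^ (s * Suc k)) / (1 + x ^ Suc k)) \<and>
         graded_parafermionic s x =
           (\<Prod>k. (1 + (-1) ^ (s - 1) * x ^ (s * Suc k)) / (1 + x ^ Suc k))"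
proof -
  have "\<bar>x ^ s\<bar> < 1"
    using assms by (simp add: power_less_one_iff)
  \<comment> \<open>The ratio is \<open>x ^ s\<close>, and the sign, constant in \<open>k\<close>,
    serves as the coefficient \<open>c\<close>.\<close>
  then have num: "convergent_prod (\<lambda>k. 1 + (-1) ^ (s - 1) * x ^ (s * Suc k))"
    using convergent_prod_one_plus_geometric[of "x ^ s" "(-1) ^ (s - 1)"]
    by (simp only: power_mult)
  have den: "convergent_prod (\<lambda>k. 1 + x ^ Suc k)"
    using convergent_prod_one_plus_geometric[of x 1] assms by simp
  \<comment> \<open>\<open>convergent_prod_divide\<close> asks for a divisor product without zero
    factors.\<close>
  have "1 + x ^ Suc k \<noteq> 0" for k
    using zero_less_power[OF assms(2), of "Suc k"] by linarith
  then have "convergent_prod (\<lambda>k. (1 + (-1) ^ (s - 1) * x ^ (s * Suc k)) / (1 + x ^ Suc k))"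
    by (intro convergent_prod_divide num den)
  then show ?thesis
    unfolding graded_parafermionic_def graded_parafermionic_factor_eq[OF assms(1,2)] by blast
qed

end
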